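(* Let $\mathcal T$ be a conical poset, $S$ a finite set of random variables, and $\mathscr A$ a set of affects relations over $S$ containing an affects causal loop of type ACL1, ACL2a, ACL3, ACL4, ACL5, ACL6 or ACL6a. Then there is no non-degenerate embedding of $S$ into $\mathcal T$ compatible with $\mathscr A$.
   Context: Affects relations. Elements of $\mathscr A$ are affects relations $X\models Y\mid\{\mathrm{do}(Z),W\}$ with $X,Y,Z,W\subseteq S$ pairwise disjoint and $X,Y$ non-empty ($X\models Y$ if $Z=W=\emptyset$), some of which are irreducible. (In a causal model, $X\models Y\mid\{\mathrm{do}(Z),W\}$ means $P_{\mathcal G_{\mathrm{do}(X\cup Z)}}(Y|x,z,w)\ne P_{\mathcal G_{\mathrm{do}(Z)}}(Y|z,w)$ for some values, and it is irreducible if $s_X\models Y\mid\{\mathrm{do}(Z\cup(X\setminus s_X)),W\}$ for all non-empty $s_X\subsetneq X$; for this statement only the resulting sets of relations and their irreducibility matter.) Loops. All sets below are non-empty subsets of $S$, and all relations are in $\mathscr A$ and irreducible. A complete affects chain from $S_1$ to $S_n$ ($n\ge2$): sets $S_i\subseteq\hat S_i$ with $\hat S_i\models S_{i+1}$ for all $1\le i<n$. - ACL1: single variables $X,Y$ with $X\models Y$, $Y\models X$. - ACL2a: single variables with $X\models Z_1\models\dots\models Z_k\models Y\models X$ ($k\ge0$). - ACL3: disjoint $S_1,S_2$, $e_1\in S_1$, $e_2\in S_2$ with $S_1\models e_2$ and $S_2\models e_1$. - ACL5: a complete affects chain from some $S_1$ to itself; ACL4: an ACL5 with $S_i=\hat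 S_i$ for all $i$. - ACL6: $S_1\models S_2$, and for each $e_2\in S_2$ there are $s_1\subseteq S_1$ and a complete affects chain from $\{e_2\}$ to $s_1$. - ACL6a: Given $S_1$, define inductively (finitely many applications) when a set $T$ returns to $S_1$: for each $e\in T$ there is a complete affects chain from $\{e\}$ either to some $s_1\subseteq S_1$ or to some $T'$ disjoint from $T$ that returns to $S_1$. An ACL6a consists of $S_1,S_2$ with a complete affects chain from $S_1$ to $S_2$ such that $S_2$ returns to $S_1$. Embeddings. A poset $\mathcal T$ is a set with a strict partial order $\prec$ ($\preceq$ its reflexive closure). An embedding of $S$ into $\mathcal T$ assigns to each $X\in S$ a location $O(X)\in\mathcal T$ and an accessible region $\mathcal R_X\subseteq\mathcal T$; for sets, $\mathcal R_X:=\bigcap_{X_i\in X}\mathcal R_{X_i}$. The future of a variable is $\bar{\mathcal F}(X)=\{a\in\mathcal T: a\succeq O(X)\}$ and for a set $X$ the support future is $\bar{\mathcal F}_s(X)=\bigcap_{X_i\in X}\bar{\mathcal F}(X_i)$. The embedding is compatible with $\mathscr A$ if (compat1) $\mathcal R_Y\cap\mathcal R_W\cap\mathcal R_Z\subseteq\mathcal R_X$ for every irreducible $X\models Y\mid\{\mathrm{do}(Z),W\}$ in $\mathscr A$, and (compat2) $\mathcal R_X=\bar{\mathcal F}(X)$ for every $X\in S$. It is non-degenerate if $O$ is injective. Conicality. An ordered random variable (ORV) on $\mathcal T$ is a random variable with a location in $\mathcal T$. For a finite set $\mathcal X$ of ORVs, $\mathrm{span}(\mathcal X)$ is the union of all $s\subseteq\mathcal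 X$ with $\bar{\mathcal F}_s(s)=\bar{\mathcal F}_s(\mathcal X)$ and $\bar{\mathcal F}_s(t)\neq\bar{\mathcal F}_s(\mathcal X)$ for all $t\subsetneq s$. $\mathcal T$ is conical if $\bar{\mathcal F}_s(\mathcal X)$ determines the locations of the elements of $\mathrm{span}(\mathcal X)$: whenever $\bar{\mathcal F}_s(\mathcal X)=\bar{\mathcal F}_s(\mathcal X')$ for finite non-empty sets of ORVs, the sets of locations of $\mathrm{span}(\mathcal X)$ and $\mathrm{span}(\mathcal X')$ coincide. *)

theory Defs
  imports Main
begin

section \<open>Affects relations\<close>

text \<open>\<open>Affects X Y Z W\<close> is the relation \<open>X \<Turnstile> Y | {do(Z), W}\<close>. Random variables enter only as
  the elements of an arbitrary type \<open>'v\<close>.\<close>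

datatype 'v affects = Affects "'v set" "'v set" "'v set" "'v set"

fun affects_over :: "'v set \<Rightarrow> 'v affects \<Rightarrow> bool" where
  "affects_over S (Affects X Y Z W) \<longleftrightarrow>
     X \<subseteq> S \<and> Y \<subseteq> S \<and> Z \<subseteq> S \<and> W \<subseteq> S \<and> X \<noteq> {} \<and> Y \<noteq> {} \<and>
     X \<inter> Y = {} \<and> X \<inter> Z = {} \<and> X \<inter> W = {} \<and> Y \<inter> Z = {} \<and> Y \<inter> W = {} \<and> Z \<inter> W = {}"

text \<open>Irreducibility refers to the relations \<open>M\<close> that hold in the underlying causal model. The set
  \<open>A\<close> under consideration below is any subset of \<open>M\<close>; in particular \<open>A\<close> need not itself contain
  the relations that witness the irreducibility of its members (but \<open>M = A\<close> is allowed).\<close>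

fun irreducible_in :: "'v affects set \<Rightarrow> 'v affects \<Rightarrow> bool" where
  "irreducible_in M (Affects X Y Z W) \<longleftrightarrow>
     (\<forall>s. s \<noteq> {} \<and> s \<subset> X \<longrightarrow> Affects s Y (Z \<union> (X - s)) W \<in> M)"

definition irr_affects :: "'v affects set \<Rightarrow> 'v affects set \<Rightarrow> 'v set \<Rightarrow> 'v set \<Rightarrow> bool" where
  "irr_affects M A X Y \<longleftrightarrow>
     Affects X Y {} {} \<in> A \<and> irreducible_in M (Affects X Y {} {})"

section \<open>Affects causal loops\<close>

text \<open>The sets of the chain are \<open>C 1, \<dots>, C n\<close>, their supersets \<open>H 1, \<dots>, H (n - 1)\<close>.\<close>

definition chain_via ::
  "'v set \<Rightarrow> 'v affects set \<Rightarrow> 'v affects set \<Rightarrow> nat \<Rightarrow> (nat \<Rightarrow> 'v set) \<Rightarrow> (nat \<Rightarrow> 'v set) \<Rightarrow> bool"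
where
  "chain_via S M A n C H \<longleftrightarrow> n \<ge> 2 \<and>
     (\<forall>i\<in>{1..n}. C i \<noteq> {} \<and> C i \<subseteq> S) \<and>
     (\<forall>i\<in>{1..<n}. C i \<subseteq> H i \<and> H i \<subseteq> S \<and> irr_affects M A (H i) (C (i + 1)))"

definition complete_chain ::
  "'v set \<Rightarrow> 'v affects set \<Rightarrow> 'v affects set \<Rightarrow> 'v set \<Rightarrow> 'v set \<Rightarrow> bool" where
  "complete_chain S M A P Q \<longleftrightarrow> (\<exists>n C H. chain_via S M A n C H \<and> C 1 = P \<and> C n = Q)"

definition ACL1 :: "'v set \<Rightarrow> 'v affects set \<Rightarrow> 'v affects set \<Rightarrow> bool" where
  "ACL1 S M A \<longleftrightarrow> (\<exists>X\<in>S. \<exists>Y\<in>S. irr_affects M A {X} {Y} \<and> irr_affects M A {Y} {X})"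

definition ACL2a :: "'v set \<Rightarrow> 'v affects set \<Rightarrow> 'v affects set \<Rightarrow> bool" where
  "ACL2a S M A \<longleftrightarrow> (\<exists>X\<in>S. \<exists>Y\<in>S. \<exists>Zs. set Zs \<subseteq> S \<and>
     successively (\<lambda>U V. irr_affects M A {U} {V}) (X # Zs @ [Y, X]))"

definition ACL3 :: "'v set \<Rightarrow> 'v affects set \<Rightarrow> 'v affects set \<Rightarrow> bool" where
  "ACL3 S M A \<longleftrightarrow> (\<exists>S1 S2. S1 \<subseteq> S \<and> S2 \<subseteq> S \<and> S1 \<inter> S2 = {} \<and>
     (\<exists>e1\<in>S1. \<exists>e2\<in>S2. irr_affects M A S1 {e2} \<and> irr_affects M A S2 {e1}))"

definition ACL5 :: "'v set \<Rightarrow> 'v affects set \<Rightarrow> 'v affects set \<Rightarrow> bool" where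
  "ACL5 S M A \<longleftrightarrow> (\<exists>S1. complete_chain S M A S1 S1)"

definition ACL4 :: "'v set \<Rightarrow> 'v affects set \<Rightarrow> 'v affects set \<Rightarrow> bool" where
  "ACL4 S M A \<longleftrightarrow>
     (\<exists>n C H. chain_via S M A n C H \<and> C n = C 1 \<and> (\<forall>i\<in>{1..<n}. C i = H i))"

definition ACL6 :: "'v set \<Rightarrow> 'v affects set \<Rightarrow> 'v affects set \<Rightarrow> bool" where
  "ACL6 S M A \<longleftrightarrow> (\<exists>S1 S2. S1 \<noteq> {} \<and> S1 \<subseteq> S \<and> S2 \<noteq> {} \<and> S2 \<subseteq> S \<and>
     irr_affects M A S1 S2 \<and>
     (\<forall>e2\<in>S2. \<exists>s1. s1 \<noteq> {} \<and> s1 \<subseteq> S1 \<and> complete_chain S M A {e2} s1))"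

inductive returns_to ::
  "'v set \<Rightarrow> 'v affects set \<Rightarrow> 'v affects set \<Rightarrow> 'v set \<Rightarrow> 'v set \<Rightarrow> bool"
  for S M A S1 where
  "\<lbrakk>T \<noteq> {}; T \<subseteq> S;
    \<forall>e\<in>T. (\<exists>s1. s1 \<noteq> {} \<and> s1 \<subseteq> S1 \<and> complete_chain S M A {e} s1) \<or>
          (\<exists>T'. T' \<inter> T = {} \<and> complete_chain S M A {e} T' \<and> returns_to S M A S1 T')\<rbrakk>
   \<Longrightarrow> returns_to S M A S1 T"

definition ACL6a :: "'v set \<Rightarrow> 'v affects set \<Rightarrow> 'v affects set \<Rightarrow> bool" where
  "ACL6a S M A \<longleftrightarrow> (\<exists>S1 S2. complete_chain S M A S1 S2 \<and> returns_to S M A S1 S2)"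

section \<open>Ordered random variables and conical posets\<close>

text \<open>The poset is the type \<open>'p::order\<close>. An intersection over the empty set is the whole poset,
  here and for the regions below.\<close>

datatype ('v, 'p) orv = ORV (variable: 'v) (location: 'p)

definition future :: "('v, 'p::order) orv \<Rightarrow> 'p set" where
  "future X = {a. a \<ge> location X}"

definition support_future :: "('v, 'p::order) orv set \<Rightarrow> 'p set" where
  "support_future \<X> = (\<Inter>X\<in>\<X>. future X)"

definition orv_span :: "('v, 'p::order) orv set \<Rightarrow> ('v, 'p) orv set" where
  "orv_span \<X> = \<Union>{s. s \<subseteq> \<X> \<and> support_future s = support_future \<X> \<and>
                      (\<forall>t. t \<subset> s \<longrightarrow> support_future t \<noteq> support_future \<X>)}"

text \<open>The type argument fixes the poset \<open>'p\<close> and the type \<open>'v\<close> of random variables used to form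
  ORVs; since only locations matter, the truth value does not depend on \<open>'v\<close>.\<close>

definition conical :: "('v, 'p::order) orv itself \<Rightarrow> bool" where
  "conical _ \<longleftrightarrow> (\<forall>(\<X> :: ('v, 'p) orv set) (\<X>' :: ('v, 'p) orv set).
     finite \<X> \<and> \<X> \<noteq> {} \<and> finite \<X>' \<and> \<X>' \<noteq> {} \<and> support_future \<X> = support_future \<X>'
     \<longrightarrow> location ` orv_span \<X> = location ` orv_span \<X>')"

section \<open>Embeddings\<close>

text \<open>An embedding is given by the locations \<open>loc X\<close> and the accessible regions \<open>R X\<close>; only their
  values on \<open>S\<close> are used.\<close>

definition region :: "('v \<Rightarrow> 'p set) \<Rightarrow> 'v set \<Rightarrow> 'p set" where
  "region R X = (\<Inter>x\<in>X. R x)"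

definition compat1 :: "'v affects set \<Rightarrow> 'v affects set \<Rightarrow> ('v \<Rightarrow> 'p set) \<Rightarrow> bool" where
  "compat1 M A R \<longleftrightarrow> (\<forall>X Y Z W. Affects X Y Z W \<in> A \<and> irreducible_in M (Affects X Y Z W) \<longrightarrow>
     region R Y \<inter> region R W \<inter> region R Z \<subseteq> region R X)"

definition compat2 :: "'v set \<Rightarrow> ('v \<Rightarrow> 'p::order) \<Rightarrow> ('v \<Rightarrow> 'p set) \<Rightarrow> bool" where
  "compat2 S loc R \<longleftrightarrow> (\<forall>X\<in>S. R X = future (ORV X (loc X)))"

definition compatible ::
  "'v set \<Rightarrow> 'v affects set \<Rightarrow> 'v affects set \<Rightarrow> ('v \<Rightarrow> 'p::order) \<Rightarrow> ('v \<Rightarrow> 'p set) \<Rightarrow> bool" where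
  "compatible S M A loc R \<longleftrightarrow> compat1 M A R \<and> compat2 S loc R"

definition nondegenerate :: "'v set \<Rightarrow> ('v \<Rightarrow> 'p) \<Rightarrow> bool" where
  "nondegenerate S loc \<longleftrightarrow> inj_on loc S"

end

(* By compat1 an irreducible relation X |= Y gives R_Y \<subseteq> R_X, so regions shrink along a complete
   affects chain. Closing up a loop forces equality throughout, hence some relation H |= C of the
   loop has R_H = R_C, although H and C are disjoint. Conicality turns equal support futures into
   equal locations of the spans, so some variable of H shares its location with one of C, which
   contradicts injectivity. *)
theory Submission imports Defs begin

section \<open>Spans of finite sets of ORVs\<close>

lemma exists_minimal_support:
  fixes \<X> :: "('v, 'p::order) orv set"
  assumes "finite \<X>"
  obtains s where "s \<subseteq> \<X>" "support_future s = support_future \<X>"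
    "\<And>t. t \<subset> s \<Longrightarrow> support_future t \<noteq> support_future \<X>"
proof -
  let ?F = "{s. s \<subseteq> \<X> \<and> support_future s = support_future \<X>}"
  have "finite ?F" "?F \<noteq> {}"
    using assms by auto
  then obtain s where "s \<in> ?F" "\<forall>t\<in>?F. t \<subseteq> s \<longrightarrow> s = t"
    using finite_has_minimal[of ?F] by blast
  then show thesis
    by (intro that[of s]) auto
qed

(* A minimal generating subset is empty exactly when the common future is the whole poset. *)
lemma orv_span_nonempty:
  fixes \<X> :: "('v, 'p::order) orv set"
  assumes "finite \<X>" "support_future \<X> \<noteq> UNIV"
  shows "orv_span \<X> \<noteq> {}"
proof -
  obtain s where s: "s \<subseteq> \<X>" "support_future s = support_future \<X>"
    "\<And>t. t \<subset> s \<Longrightarrow> support_future t \<noteq> support_future \<X>"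
    using exists_minimal_support assms(1) by blast
  then have "s \<subseteq> orv_span \<X>"
    unfolding orv_span_def by blast
  moreover have "s \<noteq> {}"
    using s(2) assms(2) by (auto simp: support_future_def)
  ultimately show ?thesis
    by blast
qed

lemma orv_span_subset: "orv_span \<X> \<subseteq> \<X>"
  unfolding orv_span_def by blast

text \<open>Conicality identifies the locations of the two spans, so any element of one span has a
  partner in the other. This works only if the spans are non-empty; when the common future is the
  whole poset they are empty, and a separate argument is required.\<close>

lemma conical_common_location:
  fixes \<X> \<Y> :: "('v, 'p::order) orv set"
  assumes conical: "conical TYPE(('v, 'p) orv)"
    and fin: "finite \<X>" "finite \<Y>" and ne: "\<X> \<noteq> {}" "\<Y> \<noteq> {}"
    and eq: "support_future \<X> = support_future \<Y>"
  obtains x y where "x \<in> \<X>" "y \<in> \<Y>" "location x = location y"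
proof (cases "support_future \<X> = UNIV")
  case True
  obtain x y where xy: "x \<in> \<X>" "y \<in> \<Y>"
    using ne by blast
  \<comment> \<open>Each of the two futures is the whole poset, so each location lies below the
    other and antisymmetry applies.\<close>
  moreover have "location y \<in> future x" "location x \<in> future y"
    using True eq xy by (auto simp: support_future_def)
  then have "location x = location y"
    by (auto simp: future_def)
  ultimately show thesis
    using that by blast
next
  case False
  then obtain x where x: "x \<in> orv_span \<X>"
    using orv_span_nonempty fin by blast
  have "location ` orv_span \<X> = location ` orv_span \<Y>"
    using conical fin ne eq unfolding conical_def by blast
  then obtain y where "y \<in> orv_span \<Y>" "location x = location y"
    using x by (metis imageE imageI)
  then show thesis
    using that x orv_span_subset by blast
qed

section \<open>Regions along affects chains\<close>

lemma region_antimono: "X \<subseteq> Y \<Longrightarrow> region R Y \<subseteq> region R X"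
  unfolding region_def by blast

lemma region_empty [simp]: "region R {} = UNIV"
  by (simp add: region_def)

lemma region_eq_support_future:
  assumes "compat2 S loc R" "X \<subseteq> S"
  shows "region R X = support_future ((\<lambda>x. ORV x (loc x)) ` X)"
  using assms unfolding region_def support_future_def compat2_def by auto

lemma irr_affects_region:
  assumes "compat1 M A R" "irr_affects M A X Y"
  shows "region R Y \<subseteq> region R X"
proof -
  have "region R Y \<inter> region R {} \<inter> region R {} \<subseteq> region R X"
    using assms unfolding compat1_def irr_affects_def by blast
  then show ?thesis
    by simp
qed

lemma chain_via_region:
  assumes "compat1 M A R" and chain: "chain_via S M A n C H"
    and "1 \<le> i" "i \<le> j" "j \<le> n"
  shows "region R (C j) \<subseteq> region R (C i)"
  using \<open>i \<le> j\<close> \<open>j \<le> n\<close>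
proof (induction j rule: dec_induct)
  case base
  then show ?case by simp
next
  case (step j)
  then have "j \<in> {1..<n}"
    using \<open>1 \<le> i\<close> by simp
  then have "C j \<subseteq> H j" "irr_affects M A (H j) (C (Suc j))"
    using chain unfolding chain_via_def by auto
  then have "region R (C (Suc j)) \<subseteq> region R (C j)"
    by (intro order_trans[OF irr_affects_region[OF assms(1)] region_antimono])
  then show ?case
    using step by auto
qed

text \<open>Since \<open>n \<ge> 2\<close>, a first link exists. It is isolated because an inclusion
  of \<open>region R P\<close> in \<open>region R Q\<close> would then force
  \<open>region R H \<subseteq> region R C\<close> for a single irreducible relation.\<close>

lemma complete_chain_first_link:
  assumes "compat1 M A R" "complete_chain S M A P Q"
  obtains H C where "irr_affects M A H C" "region R Q \<subseteq> region R C" "region R H \<subseteq> region R P"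
proof -
  obtain n C H where chain: "chain_via S M A n C H" and ends: "C 1 = P" "C n = Q"
    using assms(2) unfolding complete_chain_def by blast
  then have "n \<ge> 2"
    unfolding chain_via_def by blast
  then have "1 \<in> {1..<n}"
    by simp
  then have "irr_affects M A (H 1) (C (1 + 1))" "C 1 \<subseteq> H 1"
    using chain unfolding chain_via_def by blast+
  moreover have "region R (H 1) \<subseteq> region R (C 1)"
    using calculation(2) by (rule region_antimono)
  moreover have "region R (C n) \<subseteq> region R (C (1 + 1))"
    using \<open>n \<ge> 2\<close> by (intro chain_via_region[OF assms(1) chain]) auto
  ultimately show thesis
    using that[of "H 1" "C (1 + 1)"] ends by simp
qed

lemma complete_chain_region:
  assumes "compat1 M A R" "complete_chain S M A P Q"
  shows "region R Q \<subseteq> region R P"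
proof -
  obtain H C where
    "irr_affects M A H C" "region R Q \<subseteq> region R C" "region R H \<subseteq> region R P"
    using complete_chain_first_link[OF assms] .
  then show ?thesis
    using irr_affects_region[OF assms(1)] by blast
qed

lemma region_subsetI:
  assumes "\<And>e. e \<in> T \<Longrightarrow> B \<subseteq> region R {e}"
  shows "B \<subseteq> region R T"
  using assms unfolding region_def by blast

text \<open>Induction on the return: for each \<open>e\<close> in \<open>T\<close> the chain from
  \<open>{e}\<close> ends in a set whose region contains that of \<open>S1\<close>, by
  antimonotonicity if the end lies in \<open>S1\<close> and by the induction hypothesis otherwise.
  Intersecting over \<open>e\<close> gives the claim.\<close>

lemma returns_to_region:
  assumes "compat1 M A R" "returns_to S M A S1 T"
  shows "region R S1 \<subseteq> region R T"
  using assms(2)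
proof induction
  case (1 T)
  show ?case
  proof (rule region_subsetI)
    fix e assume "e \<in> T"
    then consider
        s1 where "s1 \<subseteq> S1" "complete_chain S M A {e} s1"
      | T' where "complete_chain S M A {e} T'" "region R S1 \<subseteq> region R T'"
      using bspec[OF 1(3)] by metis
    then show "region R S1 \<subseteq> region R {e}"
    proof cases
      case 1
      then show ?thesis
        by (rule order_trans[OF region_antimono complete_chain_region[OF assms(1)]])
    next
      case 2
      then show ?thesis
        using complete_chain_region[OF assms(1) 2(1)] by blast
    qed
  qed
qed

text \<open>The inclusion would be an equality by \<open>compat1\<close>, hence an equality of
  support futures by \<open>compat2\<close>. Conicality then yields a location shared by members of
  the disjoint sets \<open>X\<close> and \<open>Y\<close>, against injectivity.\<close>

lemma irr_affects_not_equal_region: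
  fixes loc :: "'v \<Rightarrow> 'p::order"
  assumes conical: "conical TYPE(('v, 'p) orv)" and fin: "finite S"
    and over: "\<forall>r\<in>M. affects_over S r" and sub: "A \<subseteq> M"
    and compat: "compatible S M A loc R" and nondeg: "nondegenerate S loc"
    and irr: "irr_affects M A X Y"
  shows "\<not> region R X \<subseteq> region R Y"
proof
  assume le: "region R X \<subseteq> region R Y"
  let ?orv = "\<lambda>x. ORV x (loc x)"
  have compats: "compat1 M A R" "compat2 S loc R"
    using compat unfolding compatible_def by auto
  have "affects_over S (Affects X Y {} {})"
    using irr over sub unfolding irr_affects_def by blast
  then have XY: "X \<subseteq> S" "Y \<subseteq> S" "X \<noteq> {}" "Y \<noteq> {}" "X \<inter> Y = {}"
    by auto
  have "support_future (?orv ` X) = support_future (?orv ` Y)"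
    using le irr_affects_region[OF compats(1) irr] XY
    by (simp flip: region_eq_support_future[OF compats(2)])
  moreover have "finite X" "finite Y"
    using XY fin by (simp_all add: finite_subset)
  ultimately obtain u w where "u \<in> ?orv ` X" "w \<in> ?orv ` Y" "location u = location w"
    using conical_common_location[OF conical, of "?orv ` X" "?orv ` Y"] XY by auto
  then obtain x y where "x \<in> X" "y \<in> Y" "loc x = loc y"
    by auto
  moreover have "inj_on loc S"
    using nondeg unfolding nondegenerate_def .
  ultimately show False
    using XY by (metis disjoint_iff inj_onD subsetD)
qed

lemma complete_chain_not_closed:
  fixes loc :: "'v \<Rightarrow> 'p::order"
  assumes "conical TYPE(('v, 'p) orv)" "finite S"
    and "\<forall>r\<in>M. affects_over S r" "A \<subseteq> M"
    and compat: "compatible S M A loc R" and "nondegenerate S loc"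
    and chain: "complete_chain S M A P Q"
  shows "\<not> region R P \<subseteq> region R Q"
proof -
  have "compat1 M A R"
    using compat unfolding compatible_def by blast
  then obtain H C where
    "irr_affects M A H C" "region R Q \<subseteq> region R C" "region R H \<subseteq> region R P"
    using complete_chain_first_link chain by blast
  then show ?thesis
    using irr_affects_not_equal_region[OF assms(1-6)] by blast
qed

section \<open>Closing inclusions for the individual loop types\<close>

lemma ACL4_imp_ACL5: "ACL4 S M A \<Longrightarrow> ACL5 S M A"
  unfolding ACL4_def ACL5_def complete_chain_def by metis

text \<open>The link chosen is the one leaving the first \<open>X\<close>; following the rest of the
  loop back to \<open>X\<close> gives the opposite inclusion.\<close>

lemma ACL2a_closed_link:
  assumes "compat1 M A R" "ACL2a S M A"
  obtains X Y where "irr_affects M A {X} {Y}" "region R {X} \<subseteq> region R {Y}"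
proof -
  obtain X Y Zs where
    "successively (\<lambda>U V. irr_affects M A {U} {V}) (X # Zs @ [Y, X])"
    using assms(2) unfolding ACL2a_def by blast
  \<comment> \<open>Here \<open>b\<close> is the first intermediate variable, or \<open>Y\<close> if
    there is none; in both cases the final \<open>X\<close> lies in the tail
    \<open>l\<close>.\<close>
  moreover obtain b l where bl: "Zs @ [Y, X] = b # l" "X \<in> set l"
    by (cases Zs) auto
  ultimately have link: "irr_affects M A {X} {b}"
    and succ: "successively (\<lambda>U V. irr_affects M A {U} {V}) (b # l)"
    by auto
  have "successively (\<lambda>U V. region R {V} \<subseteq> region R {U}) (b # l)"
    using succ by (rule successively_mono) (rule irr_affects_region[OF assms(1)])
  \<comment> \<open>Transitivity of inclusion extends the relation from neighbours to all pairs, in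
    particular to \<open>b\<close> and the later \<open>X\<close>.\<close>
  then have "sorted_wrt (\<lambda>U V. region R {V} \<subseteq> region R {U}) (b # l)"
    by (subst (asm) successively_iff_sorted_wrt_strong) auto
  then show thesis
    using that link bl by auto
qed

text \<open>The two relations interlock: \<open>region R S1 \<subseteq> region R {e1} \<subseteq>
  region R S2 \<subseteq> region R {e2}\<close>.\<close>

lemma ACL3_closed_link:
  assumes "compat1 M A R" "ACL3 S M A"
  obtains X Y where "irr_affects M A X Y" "region R X \<subseteq> region R Y"
proof -
  obtain S1 S2 e1 e2 where "e1 \<in> S1" "e2 \<in> S2"
    and irr: "irr_affects M A S1 {e2}" "irr_affects M A S2 {e1}"
    using assms(2) unfolding ACL3_def by blast
  then have "region R S1 \<subseteq> region R {e1}" "region R S2 \<subseteq> region R {e2}"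
    by (auto intro!: region_antimono)
  then show thesis
    using that irr irr_affects_region[OF assms(1)] by blast
qed

text \<open>Each \<open>e2\<close> satisfies \<open>region R S1 \<subseteq> region R s1 \<subseteq>
  region R {e2}\<close>; intersecting over \<open>S2\<close> closes the link from \<open>S1\<close>
  to \<open>S2\<close>.\<close>

lemma ACL6_closed_link:
  assumes "compat1 M A R" "ACL6 S M A"
  obtains X Y where "irr_affects M A X Y" "region R X \<subseteq> region R Y"
proof -
  obtain S1 S2 where irr: "irr_affects M A S1 S2"
    and ret: "\<forall>e2\<in>S2. \<exists>s1. s1 \<noteq> {} \<and> s1 \<subseteq> S1 \<and> complete_chain S M A {e2} s1"
    using assms(2) unfolding ACL6_def by blast
  have "region R S1 \<subseteq> region R S2"
  proof (rule region_subsetI)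
    fix e2 assume "e2 \<in> S2"
    then obtain s1 where "s1 \<subseteq> S1" "complete_chain S M A {e2} s1"
      using ret by blast
    then show "region R S1 \<subseteq> region R {e2}"
      by (rule order_trans[OF region_antimono complete_chain_region[OF assms(1)]])
  qed
  then show thesis
    using that irr by blast
qed

theorem corollary5p14:
  fixes S :: "'v set" and M A :: "'v affects set"
  assumes "conical TYPE(('v, 'p::order) orv)"
    and "finite S"
    and "\<forall>r\<in>M. affects_over S r"
    and "A \<subseteq> M"
    and "ACL1 S M A \<or> ACL2a S M A \<or> ACL3 S M A \<or> ACL4 S M A \<or> ACL5 S M A \<or> ACL6 S M A \<or> ACL6a S M A"
  shows "\<not> (\<exists>(loc :: 'v \<Rightarrow> 'p) (R :: 'v \<Rightarrow> 'p set). compatible S M A loc R \<and> nondegenerate S loc)"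
proof
  assume "\<exists>(loc :: 'v \<Rightarrow> 'p) (R :: 'v \<Rightarrow> 'p set). compatible S M A loc R \<and> nondegenerate S loc"
  then obtain loc :: "'v \<Rightarrow> 'p" and R where emb: "compatible S M A loc R" "nondegenerate S loc"
    by blast
  then have c1: "compat1 M A R"
    unfolding compatible_def by blast
  note no_closed_link = irr_affects_not_equal_region[OF assms(1-4) emb]
  note no_closed_chain = complete_chain_not_closed[OF assms(1-4) emb]
  consider "ACL1 S M A" | "ACL2a S M A" | "ACL3 S M A" | "ACL5 S M A" | "ACL6 S M A" | "ACL6a S M A"
    using assms(5) ACL4_imp_ACL5 by blast
  then show False
  proof cases
    case 1
    then show False
      \<comment> \<open>Either relation supplies the inclusion that is forbidden for the
        other.\<close>
      using no_closed_link irr_affects_region[OF c1] unfolding ACL1_def by blast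
  next
    case 2
    then show False
      using ACL2a_closed_link[OF c1] no_closed_link by blast
  next
    case 3
    then show False
      using ACL3_closed_link[OF c1] no_closed_link by blast
  next
    case 4
    then show False
      using no_closed_chain unfolding ACL5_def by blast
  next
    case 5
    then show False
      using ACL6_closed_link[OF c1] no_closed_link by blast
  next
    case 6
    then show False
      \<comment> \<open>The return of \<open>S2\<close> to \<open>S1\<close> gives the inclusion
        that the chain from \<open>S1\<close> to \<open>S2\<close> excludes.\<close>
      using no_closed_chain returns_to_region[OF c1] unfolding ACL6a_def by blast
  qed
qed

end
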